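(* Let $A\in\mathbb{R}^{k\times n}$, let $\Gamma_{\mathrm{prior}}\in\mathbb{R}^{n\times n}$ and $\Gamma_{\mathrm{noise}}\in\mathbb{R}^{k\times k}$ be symmetric positive definite matrices, let $\Gamma_{\mathrm{post}}:=(\Gamma_{\mathrm{prior}}^{-1}+A^\top\Gamma_{\mathrm{noise}}^{-1}A)^{-1}$, and let $\delta_{\mathrm{prior}}:=\operatorname{tr}\left[(I-A^+A)(\Gamma_{\mathrm{prior}}-\Gamma_{\mathrm{post}})\right]$. Then $$\delta_{\mathrm{prior}}\le\sum_{i=1}^{\mathrm{Nullity}(A)}\lambda_i(\Gamma_{\mathrm{prior}}-\Gamma_{\mathrm{post}}).$$ Moreover, this bound is tight, i.e. there exist a matrix $A\in\mathbb{R}^{k\times n}$ and symmetric positive definite matrices $\Gamma_{\mathrm{prior}}\in\mathbb{R}^{n\times n}$ and $\Gamma_{\mathrm{noise}}\in\mathbb{R}^{k\times k}$ for which, with $\Gamma_{\mathrm{post}}=(\Gamma_{\mathrm{prior}}^{-1}+A^\top\Gamma_{\mathrm{noise}}^{-1}A)^{-1}$ and $\delta_{\mathrm{prior}}=\operatorname{tr}\left[(I-A^+A)(\Gamma_{\mathrm{prior}}-\Gamma_{\mathrm{post}})\right]$, equality holds.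
   Context: $A^+$ denotes the Moore–Penrose pseudoinverse of $A$, and $I$ is the $n\times n$ identity matrix. $\mathrm{Nullity}(A)=n-\mathrm{Rank}(A)$ is the dimension of the null space of $A$. For a symmetric matrix $M\in\mathbb{R}^{n\times n}$, $\lambda_1(M)\ge\lambda_2(M)\ge\dots\ge\lambda_n(M)$ are its eigenvalues (with multiplicity) in decreasing order. *)

theory Defs
  imports
    "HOL-Analysis.Analysis"
    "HOL-Computational_Algebra.Polynomial"
begin

definition sym_pos_def :: "real^'n^'n \<Rightarrow> bool" where
  "sym_pos_def M \<longleftrightarrow>
     transpose M = M \<and> (\<forall>x. x \<noteq> 0 \<longrightarrow> x \<bullet> (M *v x) > 0)"

definition is_pinv :: "real^'n^'k \<Rightarrow> real^'k^'n \<Rightarrow> bool" where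
  "is_pinv A X \<longleftrightarrow>
     A ** X ** A = A \<and> X ** A ** X = X \<and>
     transpose (A ** X) = A ** X \<and> transpose (X ** A) = X ** A"

text \<open>The four Penrose equations have exactly one solution for every real matrix, so the
  description operator below always denotes it.\<close>

definition pinv :: "real^'n^'k \<Rightarrow> real^'k^'n" where
  "pinv A = (THE X. is_pinv A X)"

definition nullity :: "real^'n^'k \<Rightarrow> nat" where
  "nullity A = CARD('n) - rank A"

definition charpoly :: "real^'n^'n \<Rightarrow> real poly" where
  "charpoly M = det (mat [:0, 1:] - (\<chi> i j. [:M $ i $ j:]))"

text \<open>The real eigenvalues in decreasing order, repeated according to algebraic multiplicity.
  For a symmetric matrix all roots of the characteristic polynomial are real, and the list has
  length \<open>CARD('n)\<close>. Eigenvalues are numbered from 1, list positions from 0.\<close>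

definition eigvals_desc :: "real^'n^'n \<Rightarrow> real list" where
  "eigvals_desc M = rev (sorted_list_of_multiset (proots (charpoly M)))"

definition eigval :: "nat \<Rightarrow> real^'n^'n \<Rightarrow> real" where
  "eigval i M = eigvals_desc M ! (i - 1)"

definition Gamma_post :: "real^'n^'k \<Rightarrow> real^'n^'n \<Rightarrow> real^'k^'k \<Rightarrow> real^'n^'n" where
  "Gamma_post A \<Gamma>prior \<Gamma>noise =
     matrix_inv (matrix_inv \<Gamma>prior + transpose A ** matrix_inv \<Gamma>noise ** A)"

definition delta_prior :: "real^'n^'k \<Rightarrow> real^'n^'n \<Rightarrow> real^'k^'k \<Rightarrow> real" where
  "delta_prior A \<Gamma>prior \<Gamma>noise =
     trace ((mat 1 - pinv A ** A) ** (\<Gamma>prior - Gamma_post A \<Gamma>prior \<Gamma>noise))"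

end

theory Submission
  imports Defs
begin

text \<open>
  The matrix \<open>P = I - A\<^sup>+ A\<close> is the orthogonal projection onto the kernel of \<open>A\<close>. It is therefore
  symmetric and idempotent, and its trace is the dimension of the kernel, that is, the nullity of
  \<open>A\<close> (\<open>kernel_projection\<close>). The matrix \<open>M = \<Gamma>\<^sub>p\<^sub>r\<^sub>i\<^sub>o\<^sub>r - \<Gamma>\<^sub>p\<^sub>o\<^sub>s\<^sub>t\<close> is symmetric
  (\<open>sym_pos_def_Gamma_post\<close>). The inequality is thus an instance of Ky Fan's maximum principle:
  for a symmetric \<open>M\<close> and an orthogonal projection \<open>E\<close> of trace \<open>r\<close>, the trace of \<open>E M\<close> is at most
  the sum of the \<open>r\<close> largest eigenvalues of \<open>M\<close> (\<open>Ky_Fan_projection_bound\<close>).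

  To see Ky Fan's principle, write \<open>M = Q D Q\<^sup>T\<close> with \<open>Q\<close> orthogonal and \<open>D\<close> diagonal. Then
  \<open>tr (E M) = \<Sum>\<^sub>j d\<^sub>j F\<^sub>j\<^sub>j\<close> with \<open>F = Q\<^sup>T E Q\<close>, again an orthogonal projection of trace \<open>r\<close>. Its
  diagonal entries lie between 0 and 1 and add up to \<open>r\<close>, and a weighted sum with such weights is
  largest when the whole weight sits on the \<open>r\<close> largest \<open>d\<^sub>j\<close> (\<open>weighted_sum_le_sum_largest\<close>).

  Two ingredients are built on the way. The spectral theorem comes from maximising the
  quadratic form over the unit sphere of an invariant subspace and passing to the orthogonal
  complement of the maximiser (\<open>self_adjoint_eigenvector\<close>,
  \<open>self_adjoint_orthonormal_eigenbasis\<close>). It identifies the roots of the characteristic polynomial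
  with the diagonal of \<open>D\<close> (\<open>eigvals_desc_enumeration\<close>), and it also gives the existence of the
  pseudoinverse, as \<open>(A\<^sup>T A)\<^sup>+ A\<^sup>T\<close> (\<open>is_pinv_exists\<close>).

  Equality is attained at \<open>A = 0\<close>: the data then carry no information, the posterior covariance
  equals the prior one, and both sides vanish.
\<close>

section \<open>Matrix algebra\<close>

lemma transpose_add: "transpose (A + B) = transpose A + transpose B"
  by (simp add: vec_eq_iff transpose_def)

lemma transpose_diff: "transpose (A - B) = transpose A - transpose B"
  by (simp add: vec_eq_iff transpose_def)

lemma matrix_diff_distrib_left: "A ** (B - C) = A ** B - A ** C"
  for A :: "'a::comm_ring_1^'n^'m"
  by (simp add: vec_eq_iff matrix_matrix_mult_def right_diff_distrib sum_subtractf)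

lemma matrix_diff_distrib_right: "(A - B) ** C = A ** C - B ** C"
  for C :: "'a::comm_ring_1^'n^'m"
  by (simp add: vec_eq_iff matrix_matrix_mult_def left_diff_distrib sum_subtractf)

section \<open>The spectral theorem for symmetric matrices\<close>

text \<open>
  A maximiser of \<open>x \<bullet> f x\<close> on the unit sphere of \<open>S\<close> is an eigenvector: its residual \<open>y = f v - c v\<close>
  lies in \<open>S\<close>, and moving from \<open>v\<close> in direction \<open>y\<close> would increase the Rayleigh quotient to first
  order unless \<open>y = 0\<close>.
\<close>

lemma self_adjoint_eigenvector:
  fixes f :: "'a::euclidean_space \<Rightarrow> 'a"
  assumes lin: "linear f" and adj: "\<And>x y. f x \<bullet> y = x \<bullet> f y"
    and S: "subspace S" "S \<noteq> {0}" and inv: "f ` S \<subseteq> S"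
  obtains v c where "v \<in> S" "norm v = 1" "f v = c *\<^sub>R v"
proof -
  let ?K = "S \<inter> sphere 0 1"
  have "compact ?K"
    using closed_subspace[OF S(1)] compact_sphere by (metis closed_Int_compact)
  moreover obtain u where u: "u \<in> S" "u \<noteq> 0"
    using S subspace_0 by blast
  then have "u /\<^sub>R norm u \<in> ?K"
    using S(1) by (simp add: subspace_mul)
  then have "?K \<noteq> {}" by blast
  moreover have "continuous_on ?K (\<lambda>x. x \<bullet> f x)"
    by (intro continuous_intros linear_continuous_on linear_conv_bounded_linear[THEN iffD1] lin)
  ultimately obtain v where v: "v \<in> ?K" and max: "\<And>x. x \<in> ?K \<Longrightarrow> x \<bullet> f x \<le> v \<bullet> f v"
    using continuous_attains_sup[of ?K "\<lambda>x. x \<bullet> f x"] by blast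
  define c where "c = v \<bullet> f v"
  have vv: "v \<bullet> v = 1" and vS: "v \<in> S"
    using v by (auto simp: norm_eq_1)
  have bound: "x \<bullet> f x \<le> c * (x \<bullet> x)" if "x \<in> S" for x
  proof (cases "x = 0")
    case False
    then have "x /\<^sub>R norm x \<in> ?K"
      using that S(1) by (simp add: subspace_mul)
    from max[OF this] have "(x \<bullet> f x) / (norm x)\<^sup>2 \<le> c"
      by (simp add: c_def linear_cmul[OF lin] power2_eq_square divide_simps)
    with False show ?thesis
      by (simp add: power2_norm_eq_inner divide_simps)
  qed auto
  define y where "y = f v - c *\<^sub>R v"
  have yS: "y \<in> S"
    unfolding y_def using S(1) vS inv by (auto intro!: subspace_diff subspace_mul)
  define b where "b = y \<bullet> f y - c * (y \<bullet> y)"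
  \<comment> \<open>The Rayleigh bound at \<open>v + t y\<close>; the constant terms cancel because \<open>v\<close> attains it.\<close>
  have quad: "2 * t * (y \<bullet> y) + t\<^sup>2 * b \<le> 0" for t
  proof -
    have "v + t *\<^sub>R y \<in> S"
      using S(1) vS yS by (simp add: subspace_add subspace_mul)
    from bound[OF this]
    have "(v + t *\<^sub>R y) \<bullet> (f v + t *\<^sub>R f y) \<le> c * ((v + t *\<^sub>R y) \<bullet> (v + t *\<^sub>R y))"
      by (simp add: linear_add[OF lin] linear_cmul[OF lin])
    moreover have "v \<bullet> f y = y \<bullet> f v"
      by (metis adj inner_commute)
    moreover have "y \<bullet> f v = y \<bullet> y + c * (y \<bullet> v)"
      by (simp add: y_def inner_diff_right inner_diff_left inner_commute algebra_simps)
    ultimately show ?thesis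
      using vv c_def
      by (simp add: b_def inner_add_left inner_add_right algebra_simps power2_eq_square inner_commute)
  qed
  have "y \<bullet> y = 0"
  proof (rule ccontr)
    assume "y \<bullet> y \<noteq> 0"
    then have pos: "y \<bullet> y > 0" by simp
    \<comment> \<open>A step so small that the quadratic term is at most half of the linear one.\<close>
    define t where "t = (y \<bullet> y) / (1 + \<bar>b\<bar>)"
    have t: "t > 0" using pos by (simp add: t_def add_pos_nonneg)
    have "t * (2 * (y \<bullet> y) + t * b) \<le> 0"
      using quad[of t] by (simp add: algebra_simps power2_eq_square)
    then have "2 * (y \<bullet> y) + t * b \<le> 0"
      using t by (simp add: mult_le_0_iff)
    moreover have "t * \<bar>b\<bar> \<le> y \<bullet> y"
      using pos by (simp add: t_def field_simps)
    moreover have "- (t * \<bar>b\<bar>) \<le> t * b"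
      using t by (metis abs_ge_minus_self abs_le_iff abs_mult abs_of_pos minus_le_iff)
    ultimately show False using pos by linarith
  qed
  then have "f v = c *\<^sub>R v" by (simp add: y_def)
  with v that show thesis by auto
qed

text \<open>
  Induction on the dimension of \<open>S\<close>: since \<open>f\<close> is self-adjoint, the orthogonal complement of an
  eigenvector within \<open>S\<close> is again invariant. Stating the result for invariant subspaces, and not
  only for the whole space, is what makes the induction go through.
\<close>

lemma self_adjoint_orthonormal_eigenbasis:
  fixes f :: "'a::euclidean_space \<Rightarrow> 'a"
  assumes lin: "linear f" and adj: "\<And>x y. f x \<bullet> y = x \<bullet> f y"
    and "subspace S" "f ` S \<subseteq> S"
  shows "\<exists>B. B \<subseteq> S \<and> pairwise orthogonal B \<and> (\<forall>b\<in>B. norm b = 1) \<and> span B = S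
           \<and> (\<forall>b\<in>B. \<exists>c. f b = c *\<^sub>R b)"
  using assms(3,4)
proof (induction "dim S" arbitrary: S rule: less_induct)
  case less
  show ?case
  proof (cases "S = {0}")
    case True
    then show ?thesis by (intro exI[of _ "{}"]) auto
  next
    case False
    obtain v c where v: "v \<in> S" "norm v = 1" "f v = c *\<^sub>R v"
      using self_adjoint_eigenvector[OF lin adj less.prems(1) False less.prems(2)] by blast
    define T where "T = S \<inter> {x. v \<bullet> x = 0}"
    have T: "subspace T"
      unfolding T_def by (intro subspace_inter less.prems subspace_hyperplane)
    have vT: "v \<notin> T" using v(2) by (auto simp: T_def norm_eq_1)
    have "T \<subset> S" using vT v(1) unfolding T_def by blast
    then have "dim T < dim S"
      using T less.prems(1) by (metis dim_psubset span_eq_iff)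
    moreover have "f ` T \<subseteq> T"
    proof -
      have "v \<bullet> f x = 0" if "v \<bullet> x = 0" for x
        using adj[of v x] v(3) that by simp
      then show ?thesis using less.prems(2) by (auto simp: T_def)
    qed
    ultimately obtain B where B: "B \<subseteq> T" "pairwise orthogonal B" "\<forall>b\<in>B. norm b = 1"
        "span B = T" "\<forall>b\<in>B. \<exists>c. f b = c *\<^sub>R b"
      using less.hyps[OF _ T] by blast
    have "span (insert v B) = S"
    proof
      show "span (insert v B) \<subseteq> S"
        using B(1) v(1) less.prems(1) by (intro span_minimal) (auto simp: T_def)
      show "S \<subseteq> span (insert v B)"
      proof
        fix x assume x: "x \<in> S"
        have "x - (v \<bullet> x) *\<^sub>R v \<in> T"
          using x v less.prems(1)
          by (auto simp: T_def inner_diff_right norm_eq_1 intro!: subspace_diff subspace_mul)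
        then show "x \<in> span (insert v B)"
          using B(4) by (auto simp: span_insert)
      qed
    qed
    moreover have "pairwise orthogonal (insert v B)"
      using B(1,2) by (auto simp: pairwise_insert orthogonal_def T_def inner_commute)
    ultimately show ?thesis
      using B v by (intro exI[of _ "insert v B"]) (auto simp: T_def)
  qed
qed

definition diagonal_matrix :: "('n \<Rightarrow> real) \<Rightarrow> real^'n^'n" where
  "diagonal_matrix d = (\<chi> i j. if i = j then d i else 0)"

lemma matrix_mult_diagonal_nth:
  "(A ** diagonal_matrix d) $ i $ j = A $ i $ j * d j"
  by (simp add: matrix_matrix_mult_def diagonal_matrix_def if_distrib cong: if_cong)

lemma diagonal_matrix_mult:
  "diagonal_matrix d ** diagonal_matrix e = diagonal_matrix (\<lambda>i. d i * e i)"
  by (simp add: vec_eq_iff matrix_mult_diagonal_nth) (simp add: diagonal_matrix_def)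

lemma transpose_diagonal_matrix [simp]: "transpose (diagonal_matrix d) = diagonal_matrix d"
  by (simp add: vec_eq_iff transpose_def diagonal_matrix_def)

lemma symmetric_matrix_diagonalization:
  fixes M :: "real^'n^'n"
  assumes sym: "transpose M = M"
  obtains Q d where "orthogonal_matrix Q" "M = Q ** diagonal_matrix d ** transpose Q"
proof -
  have adj: "(M *v x) \<bullet> y = x \<bullet> (M *v y)" for x y
    by (metis sym dot_lmul_matrix transpose_matrix_vector)
  obtain B where B: "pairwise orthogonal B" "\<forall>b\<in>B. norm b = 1" "span B = UNIV"
      "\<forall>b\<in>B. \<exists>c. M *v b = c *\<^sub>R b"
    using self_adjoint_orthonormal_eigenbasis[of "(*v) M" UNIV] adj by auto
  have ind: "independent B"
    using B by (intro pairwise_orthogonal_independent) auto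
  then have "card B = CARD('n)"
    using B(3) dim_eq_card_independent[OF ind] dim_span[of B] by simp
  then obtain q where q: "bij_betw q (UNIV :: 'n set) B"
    using finite_same_card_bij[of "UNIV :: 'n set" B] independent_imp_finite[OF ind] by auto
  then have qB: "q i \<in> B" for i by (auto simp: bij_betw_def)
  have "\<forall>i. \<exists>c. M *v q i = c *\<^sub>R q i"
    using B(4) qB by blast
  then obtain d where d: "\<And>i. M *v q i = d i *\<^sub>R q i"
    using choice[of "\<lambda>i c. M *v q i = c *\<^sub>R q i"] by blast
  have ortho: "q i \<bullet> q j = (if i = j then 1 else 0)" for i j
  proof (cases "i = j")
    case True
    then show ?thesis using B(2) qB by (simp add: norm_eq_1)
  next
    case False
    then have "q i \<noteq> q j" using q by (auto simp: bij_betw_def inj_on_def)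
    then show ?thesis using False B(1) qB by (simp add: pairwise_def orthogonal_def)
  qed
  define Q :: "real^'n^'n" where "Q = (\<chi> i j. q j $ i)"
  have "transpose Q ** Q = mat 1"
    using ortho
    by (simp add: vec_eq_iff matrix_matrix_mult_def transpose_def Q_def mat_def inner_vec_def)
  then have Q: "orthogonal_matrix Q" by (simp add: orthogonal_matrix)
  have "(M ** Q) $ i $ j = (Q ** diagonal_matrix d) $ i $ j" for i j
  proof -
    have "(M ** Q) $ i $ j = (M *v q j) $ i"
      by (simp add: matrix_matrix_mult_def matrix_vector_mult_def Q_def)
    then show ?thesis
      by (simp add: d matrix_mult_diagonal_nth Q_def mult.commute)
  qed
  then have "M ** Q = Q ** diagonal_matrix d" by (simp add: vec_eq_iff)
  then have "M = Q ** diagonal_matrix d ** transpose Q"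
    using Q by (metis matrix_mul_assoc matrix_mul_rid orthogonal_matrix_def)
  with Q that show thesis by blast
qed

section \<open>Eigenvalues as roots of the characteristic polynomial\<close>

lemma poly_det:
  fixes A :: "real poly^'n^'n"
  shows "poly (det A) t = det (\<chi> i j. poly (A $ i $ j) t)"
  by (simp add: det_def poly_sum poly_prod)

text \<open>
  The two polynomials are compared at every real point. This keeps the whole computation among
  real matrices, where \<open>Q\<close> can be factored out of \<open>t I - Q D Q\<^sup>T\<close>.
\<close>

lemma charpoly_orthogonal_diagonal:
  assumes Q: "orthogonal_matrix Q"
  shows "charpoly (Q ** diagonal_matrix d ** transpose Q) = (\<Prod>i\<in>UNIV. [:- d i, 1:])"
proof (rule poly_ext)
  fix t
  have QQ: "Q ** transpose Q = mat 1"
    using Q by (simp add: orthogonal_matrix_def)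
  have shift: "mat t = Q ** diagonal_matrix (\<lambda>_. t) ** transpose Q"
  proof -
    have "Q ** diagonal_matrix (\<lambda>_. t) = t *\<^sub>R Q"
      by (simp add: vec_eq_iff matrix_mult_diagonal_nth mult.commute)
    then have "Q ** diagonal_matrix (\<lambda>_. t) ** transpose Q = t *\<^sub>R (Q ** transpose Q)"
      by (simp add: scalar_matrix_assoc)
    then show ?thesis
      by (simp add: QQ vec_eq_iff mat_def)
  qed
  let ?M = "Q ** diagonal_matrix d ** transpose Q"
  have "poly (charpoly ?M) t = det (mat t - ?M)"
    unfolding charpoly_def poly_det
    by (intro arg_cong[of _ _ det]) (simp add: vec_eq_iff mat_def)
  also have "mat t - ?M = Q ** (diagonal_matrix (\<lambda>_. t) - diagonal_matrix d) ** transpose Q"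
    by (simp add: shift matrix_diff_distrib_left matrix_diff_distrib_right)
  also have "diagonal_matrix (\<lambda>_. t) - diagonal_matrix d = diagonal_matrix (\<lambda>i. t - d i)"
    by (simp add: vec_eq_iff diagonal_matrix_def)
  also have "det (Q ** diagonal_matrix (\<lambda>i. t - d i) ** transpose Q)
      = det (Q ** transpose Q) * det (diagonal_matrix (\<lambda>i. t - d i))"
    by (simp add: det_mul)
  also have "det (diagonal_matrix (\<lambda>i. t - d i)) = (\<Prod>i\<in>UNIV. t - d i)"
    by (subst det_diagonal) (auto simp: diagonal_matrix_def)
  finally show "poly (charpoly ?M) t = poly (\<Prod>i\<in>UNIV. [:- d i, 1:]) t"
    by (simp add: QQ poly_prod algebra_simps)
qed

text \<open>
  Listing the indices, rather than the eigenvalues, in decreasing order lets sums over the index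
  type be rewritten as sums along \<open>eigvals_desc\<close>.
\<close>

lemma eigvals_desc_enumeration:
  fixes d :: "'n::finite \<Rightarrow> real"
  assumes Q: "orthogonal_matrix Q"
  obtains js where "distinct js" "set js = (UNIV :: 'n set)"
    "eigvals_desc (Q ** diagonal_matrix d ** transpose Q) = map d js"
    "\<And>i j. i \<le> j \<Longrightarrow> j < length js \<Longrightarrow> d (js ! j) \<le> d (js ! i)"
proof -
  obtain l where l: "set l = (UNIV :: 'n set)" "distinct l"
    using finite_distinct_list[of "UNIV :: 'n set"] by auto
  define js where "js = rev (sort_key d l)"
  have srt: "sorted (map d (rev js))" by (simp add: js_def)
  have "proots (charpoly (Q ** diagonal_matrix d ** transpose Q)) = (\<Sum>i\<in>UNIV. {#d i#})"
    unfolding charpoly_orthogonal_diagonal[OF Q] by (subst proots_prod) auto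
  also have "\<dots> = (\<Sum>i\<leftarrow>l. {#d i#})"
    unfolding l(1)[symmetric] by (rule sum.distinct_set_conv_list[OF l(2)])
  also have "\<dots> = mset (map d l)"
    by (induction l) auto
  also have "\<dots> = mset (map d (rev js))"
    by (simp add: js_def)
  finally have "eigvals_desc (Q ** diagonal_matrix d ** transpose Q) = map d js"
    using srt unfolding eigvals_desc_def
    by (simp only: sorted_list_of_multiset_mset sorted_sort_id rev_map rev_rev_ident)
  moreover have "d (js ! j) \<le> d (js ! i)" if "i \<le> j" "j < length js" for i j
  proof -
    have "sorted (rev (map d js))" using srt by (simp only: rev_map)
    then show ?thesis
      using that unfolding sorted_rev_iff_nth_mono by (metis length_map nth_map order.strict_trans1)
  qed
  ultimately show thesis
    using that[of js] l by (simp add: js_def)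
qed

section \<open>Ky Fan's maximum principle\<close>

text \<open>
  Subtract the threshold \<open>c = a (r - 1)\<close>, the smallest of the \<open>r\<close> largest values. As the weights add
  up to \<open>r\<close>, this changes both sides by \<open>c r\<close>, and the inequality then holds term by term:
  \<open>a i - c\<close> is nonnegative for \<open>i < r\<close>, where the weight is at most 1, and nonpositive afterwards,
  where the weight is at least 0.
\<close>

lemma weighted_sum_le_sum_largest:
  fixes a p :: "nat \<Rightarrow> real"
  assumes anti: "\<And>i j. i \<le> j \<Longrightarrow> j < n \<Longrightarrow> a j \<le> a i"
    and p: "\<And>i. i < n \<Longrightarrow> 0 \<le> p i" "\<And>i. i < n \<Longrightarrow> p i \<le> 1"
    and total: "(\<Sum>i<n. p i) = real r"
  shows "(\<Sum>i<n. a i * p i) \<le> (\<Sum>i<r. a i)"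
proof (cases "r = 0")
  case True
  then have "\<forall>i<n. p i = 0"
    using total p(1) sum_nonneg_eq_0_iff[of "{..<n}" p] by auto
  then show ?thesis using True by simp
next
  case False
  have "real r \<le> (\<Sum>i<n. 1)"
    unfolding total[symmetric] by (intro sum_mono) (simp add: p)
  then have rn: "r \<le> n" by simp
  define c where "c = a (r - 1)"
  have "(\<Sum>i<n. (a i - c) * p i) \<le> (\<Sum>i<n. if i < r then a i - c else 0)"
  proof (intro sum_mono)
    fix i assume i: "i \<in> {..<n}"
    show "(a i - c) * p i \<le> (if i < r then a i - c else 0)"
    proof (cases "i < r")
      case True
      then have "0 \<le> a i - c" using anti[of i "r - 1"] rn by (simp add: c_def)
      then show ?thesis using True p(2)[of i] i by (simp add: mult_left_le)
    next
      case False
      then have "a i - c \<le> 0" using anti[of "r - 1" i] i by (simp add: c_def)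
      then show ?thesis using False p(1)[of i] i by (simp add: mult_nonpos_nonneg)
    qed
  qed
  also have "\<dots> = (\<Sum>i<r. a i - c)"
    using rn by (intro sum.mono_neutral_cong_right) auto
  finally show ?thesis
    by (simp add: left_diff_distrib sum_subtractf total flip: sum_distrib_left)
qed

text \<open>
  The diagonal entry \<open>E\<^sub>i\<^sub>i\<close> is the squared norm of the \<open>i\<close>-th row, hence nonnegative and at least
  its own square.
\<close>

lemma symmetric_idempotent_diagonal_bounds:
  fixes E :: "real^'n^'n"
  assumes "transpose E = E" "E ** E = E"
  shows "0 \<le> E $ i $ i" "E $ i $ i \<le> 1"
proof -
  have sym: "E $ k $ i = E $ i $ k" for k
    by (metis assms(1) transpose_def vec_lambda_beta)
  have "E $ i $ i = (E ** E) $ i $ i" by (simp add: assms)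
  also have "\<dots> = (\<Sum>k\<in>UNIV. (E $ i $ k)\<^sup>2)"
    by (simp add: matrix_matrix_mult_def sym power2_eq_square)
  finally have eq: "E $ i $ i = (\<Sum>k\<in>UNIV. (E $ i $ k)\<^sup>2)" .
  then show nonneg: "0 \<le> E $ i $ i" by (simp add: sum_nonneg)
  have "(E $ i $ i)\<^sup>2 \<le> E $ i $ i"
    by (subst (2) eq) (rule member_le_sum, auto)
  then show "E $ i $ i \<le> 1"
    using nonneg by (cases "E $ i $ i = 0") (auto simp: power2_eq_square)
qed

text \<open>
  Changing to an eigenbasis of \<open>M\<close> turns the trace into a weighted sum of eigenvalues; the weights
  are the diagonal entries of the projection in the new coordinates.
\<close>

theorem Ky_Fan_projection_bound:
  fixes M E :: "real^'n^'n"
  assumes M: "transpose M = M" and E: "transpose E = E" "E ** E = E"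
    and r: "trace E = real r"
  shows "trace (E ** M) \<le> (\<Sum>i = 1..r. eigval i M)"
proof -
  obtain Q d where Q: "orthogonal_matrix Q" and MQ: "M = Q ** diagonal_matrix d ** transpose Q"
    using symmetric_matrix_diagonalization[OF M] .
  obtain js where js: "distinct js" "set js = UNIV" "eigvals_desc M = map d js"
    "\<And>i j. i \<le> j \<Longrightarrow> j < length js \<Longrightarrow> d (js ! j) \<le> d (js ! i)"
    using eigvals_desc_enumeration[OF Q] unfolding MQ by blast
  have QQ: "Q ** transpose Q = mat 1"
    using Q by (simp add: orthogonal_matrix_def)
  define F where "F = transpose Q ** E ** Q"
  have "transpose F = F"
    by (simp add: F_def matrix_transpose_mul E(1) matrix_mul_assoc)
  moreover have "F ** F = F"
  proof -
    have "F ** F = transpose Q ** E ** (Q ** transpose Q) ** E ** Q"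
      by (simp add: F_def matrix_mul_assoc)
    also have "\<dots> = transpose Q ** (E ** E) ** Q"
      unfolding QQ by (simp add: matrix_mul_assoc)
    finally show ?thesis by (simp add: F_def E(2))
  qed
  ultimately have bounds: "0 \<le> F $ i $ i" "F $ i $ i \<le> 1" for i
    using symmetric_idempotent_diagonal_bounds by blast+
  have "trace F = trace (E ** (Q ** transpose Q))"
    unfolding F_def by (metis matrix_mul_assoc trace_mul_sym)
  then have "trace F = real r" by (simp add: QQ r)
  have reindex: "(\<Sum>k<length js. g (js ! k)) = (\<Sum>j\<in>UNIV. g j)" for g :: "'n \<Rightarrow> real"
    by (rule sum.reindex_bij_betw) (metis bij_betw_nth js(1,2))
  have weights: "(\<Sum>k<length js. F $ (js ! k) $ (js ! k)) = real r"
    using \<open>trace F = real r\<close> by (simp add: reindex[of "\<lambda>j. F $ j $ j"] trace_def)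
  have "real r \<le> real (length js)"
    unfolding weights[symmetric]
    using sum_mono[of "{..<length js}" "\<lambda>k. F $ (js ! k) $ (js ! k)" "\<lambda>_. 1"] bounds by simp
  then have "r \<le> length js" by simp
  have "trace (E ** M) = trace (F ** diagonal_matrix d)"
    unfolding MQ F_def by (metis matrix_mul_assoc trace_mul_sym)
  also have "\<dots> = (\<Sum>k<length js. d (js ! k) * F $ (js ! k) $ (js ! k))"
    by (simp add: reindex[of "\<lambda>j. d j * F $ j $ j"] trace_def matrix_mult_diagonal_nth mult.commute)
  also have "\<dots> \<le> (\<Sum>k<r. d (js ! k))"
    by (rule weighted_sum_le_sum_largest[OF js(4) bounds weights])
  also have "\<dots> = (\<Sum>i = 1..r. eigval i M)"
    using \<open>r \<le> length js\<close> by (simp add: sum.atLeast1_atMost_eq eigval_def js(3))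
  finally show ?thesis .
qed

section \<open>The pseudoinverse and the projection onto the kernel\<close>

lemma gram_matrix_eq_0:
  fixes N :: "real^'n^'k"
  assumes "transpose N ** N = 0"
  shows "N = 0"
proof -
  have "N *v x = 0" for x
  proof -
    have "(N *v x) \<bullet> (N *v x) = x \<bullet> ((transpose N ** N) *v x)"
      by (metis dot_lmul_matrix matrix_vector_mul_assoc transpose_matrix_vector inner_commute)
    then show ?thesis using assms by simp
  qed
  then show ?thesis by (simp add: matrix_eq)
qed

text \<open>
  Both \<open>A X\<close> and \<open>A Y\<close> are symmetric and \<open>A Y A X = A X\<close>, \<open>A X A Y = A Y\<close>; transposing the first
  identity gives \<open>A X = A Y\<close>. The same argument on the other side gives \<open>X A = Y A\<close>, and a
  pseudoinverse \<open>X = X A X\<close> is determined by these two products.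
\<close>

lemma is_pinv_unique:
  assumes X: "is_pinv A X" and Y: "is_pinv A Y"
  shows "X = Y"
proof -
  have "A ** X = transpose (A ** Y ** (A ** X))"
    using X Y by (simp add: is_pinv_def matrix_mul_assoc)
  also have "\<dots> = A ** X ** (A ** Y)"
    using X Y by (simp only: is_pinv_def matrix_transpose_mul[of "A ** Y"])
  also have "\<dots> = A ** Y"
    using X by (simp add: is_pinv_def matrix_mul_assoc)
  finally have AX: "A ** X = A ** Y" .
  have "X ** A = transpose (X ** A ** (Y ** A))"
    using X Y by (simp add: is_pinv_def flip: matrix_mul_assoc)
  also have "\<dots> = Y ** A ** (X ** A)"
    using X Y by (simp only: is_pinv_def matrix_transpose_mul[of "X ** A"])
  also have "\<dots> = Y ** A"
    using X by (simp add: is_pinv_def flip: matrix_mul_assoc)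
  finally have XA: "X ** A = Y ** A" .
  have "X = X ** A ** X" using X by (simp add: is_pinv_def)
  also have "\<dots> = Y ** A ** Y" by (metis XA AX matrix_mul_assoc)
  finally show ?thesis using Y by (simp add: is_pinv_def)
qed

text \<open>
  For the symmetric matrix \<open>S = A\<^sup>T A\<close> a pseudoinverse \<open>T\<close> is obtained by inverting the nonzero
  eigenvalues, and \<open>X = T A\<^sup>T\<close> is the pseudoinverse of \<open>A\<close>. Three Penrose equations follow directly
  from those for \<open>T\<close>. The remaining one, \<open>A T S = A\<close>, holds because \<open>N = A (T S - I)\<close> satisfies
  \<open>N\<^sup>T N = (S T - I) (S T S - S) = 0\<close>.
\<close>

lemma is_pinv_exists:
  fixes A :: "real^'n^'k"
  shows "\<exists>X. is_pinv A X"
proof -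
  define S where "S = transpose A ** A"
  have "transpose S = S" by (simp add: S_def matrix_transpose_mul)
  then obtain Q d where Q: "orthogonal_matrix Q" and SQ: "S = Q ** diagonal_matrix d ** transpose Q"
    by (rule symmetric_matrix_diagonalization)
  have QQ: "transpose Q ** Q = mat 1" using Q by (simp add: orthogonal_matrix)
  \<comment> \<open>Here \<open>inverse 0 = 0\<close> leaves the zero eigenvalues alone.\<close>
  define T where "T = Q ** diagonal_matrix (\<lambda>i. inverse (d i)) ** transpose Q"
  have mult: "(Q ** diagonal_matrix a ** transpose Q) ** (Q ** diagonal_matrix b ** transpose Q)
      = Q ** diagonal_matrix (\<lambda>i. a i * b i) ** transpose Q" for a b
  proof -
    have "(Q ** diagonal_matrix a ** transpose Q) ** (Q ** diagonal_matrix b ** transpose Q)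
        = Q ** diagonal_matrix a ** (transpose Q ** Q) ** diagonal_matrix b ** transpose Q"
      by (simp add: matrix_mul_assoc)
    then show ?thesis
      by (simp add: QQ flip: diagonal_matrix_mult) (simp add: matrix_mul_assoc)
  qed
  have inv: "x * inverse x * x = x" "inverse x * x * inverse x = inverse x" for x :: real
    by (cases "x = 0"; simp)+
  have ST: "S ** T = T ** S" "S ** T ** S = S" "T ** S ** T = T"
    unfolding SQ T_def mult inv by (simp_all add: mult.commute)
  have tT: "transpose T = T"
    by (simp add: T_def matrix_transpose_mul matrix_mul_assoc)
  define X where "X = T ** transpose A"
  have XA: "X ** A = T ** S" by (simp add: X_def S_def matrix_mul_assoc)
  define N where "N = A ** (T ** S - mat 1)"
  have "transpose N ** N = (S ** T - mat 1) ** (S ** (T ** S - mat 1))"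
    unfolding N_def
    by (simp add: matrix_transpose_mul transpose_diff tT \<open>transpose S = S\<close>)
       (simp add: S_def matrix_mul_assoc)
  also have "\<dots> = 0"
    using ST(2) by (simp add: matrix_diff_distrib_left matrix_mul_assoc)
  finally have "N = 0" by (rule gram_matrix_eq_0)
  then have "A ** (X ** A) = A"
    by (simp add: N_def XA matrix_diff_distrib_left)
  moreover have "transpose (X ** A) = X ** A"
    unfolding XA by (simp add: matrix_transpose_mul tT \<open>transpose S = S\<close> ST(1))
  moreover have "X ** A ** X = X"
    unfolding XA by (metis X_def ST(3) matrix_mul_assoc)
  moreover have "transpose (A ** X) = A ** X"
    by (simp add: X_def matrix_transpose_mul tT matrix_mul_assoc)
  ultimately have "is_pinv A X"
    by (simp add: is_pinv_def matrix_mul_assoc)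
  then show ?thesis ..
qed

lemma is_pinv_pinv: "is_pinv A (pinv A)"
  unfolding pinv_def using is_pinv_exists is_pinv_unique by (metis theI)

text \<open>The kernel is the orthogonal complement of the row space.\<close>

lemma dim_kernel_eq_nullity:
  fixes A :: "real^'n^'k"
  shows "dim {x. A *v x = 0} = nullity A"
proof -
  have "A *v x = 0 \<longleftrightarrow> (\<forall>y\<in>span (rows A). orthogonal y x)" for x
  proof -
    have "A *v x = 0 \<longleftrightarrow> (\<forall>y\<in>rows A. orthogonal x y)"
      by (auto simp: rows_def orthogonal_def vec_eq_iff[of _ 0] matrix_vector_mul_component
          row_def vec_lambda_eta inner_commute)
    also have "\<dots> \<longleftrightarrow> (\<forall>y\<in>span (rows A). orthogonal x y)"
      using orthogonal_to_span span_base by blast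
    finally show ?thesis by (simp add: orthogonal_commute)
  qed
  then have "dim {x. A *v x = 0} + dim (span (rows A)) = CARD('n)"
    using dim_subspace_orthogonal_to_vectors[of "span (rows A)" UNIV] by simp
  then show ?thesis by (simp add: nullity_def row_rank_def)
qed

text \<open>
  In an orthonormal basis \<open>B\<close> of \<open>V\<close> the projection is \<open>P = \<Sum>\<^sub>b b b\<^sup>T\<close>, and each summand has trace
  \<open>b \<bullet> b = 1\<close>.
\<close>

lemma trace_orthogonal_projection:
  fixes P :: "real^'n^'n"
  assumes sym: "transpose P = P" and V: "subspace V"
    and into: "\<And>x. P *v x \<in> V" and fixed: "\<And>x. x \<in> V \<Longrightarrow> P *v x = x"
  shows "trace P = dim V"
proof -
  obtain B where B: "B \<subseteq> V" "pairwise orthogonal B" "\<And>b. b \<in> B \<Longrightarrow> norm b = 1"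
      "independent B" "card B = dim V" "span B = V"
    using orthonormal_basis_subspace[OF V] by metis
  have fin: "finite B" using B(4) independent_imp_finite by blast
  have "P *v x = (\<Sum>b\<in>B. (x \<bullet> b) *\<^sub>R b)" for x
  proof -
    have "P *v x = (\<Sum>b\<in>B. ((P *v x) \<bullet> b) *\<^sub>R b)"
      using orthonormal_basis_expand[OF B(2,3) _ fin] into B(6) by metis
    also have "\<dots> = (\<Sum>b\<in>B. (x \<bullet> b) *\<^sub>R b)"
    proof (intro sum.cong refl)
      fix b assume "b \<in> B"
      have "(P *v x) \<bullet> b = x \<bullet> (P *v b)"
        by (metis sym dot_lmul_matrix transpose_matrix_vector)
      then show "((P *v x) \<bullet> b) *\<^sub>R b = (x \<bullet> b) *\<^sub>R b"
        using fixed \<open>b \<in> B\<close> B(1) by auto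
    qed
    finally show ?thesis .
  qed
  note expand = this
  have "P $ i $ i = (\<Sum>b\<in>B. b $ i * b $ i)" for i
  proof -
    have "P $ i $ i = (P *v axis i 1) $ i"
      by (simp add: matrix_vector_mult_basis column_def)
    then show ?thesis
      by (simp add: expand inner_axis' )
  qed
  then have "trace P = (\<Sum>i\<in>UNIV. \<Sum>b\<in>B. b $ i * b $ i)"
    by (simp add: trace_def)
  also have "\<dots> = (\<Sum>b\<in>B. b \<bullet> b)"
    by (subst sum.swap) (simp add: inner_vec_def)
  also have "\<dots> = card B"
    using B(3) by (simp add: norm_eq_1)
  finally show ?thesis by (simp add: B(5))
qed

text \<open>
  All three properties come from the Penrose equations: \<open>A\<^sup>+ A\<close> is symmetric, and \<open>A A\<^sup>+ A = A\<close> says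
  \<open>A P = 0\<close>, so \<open>P\<close> maps into the kernel of \<open>A\<close>, where it acts as the identity.
\<close>

lemma kernel_projection:
  fixes A :: "real^'n^'k"
  defines "P \<equiv> mat 1 - pinv A ** A"
  shows "transpose P = P" "P ** P = P" "trace P = real (nullity A)"
proof -
  have pinv: "A ** pinv A ** A = A" "transpose (pinv A ** A) = pinv A ** A"
    using is_pinv_pinv[of A] by (auto simp: is_pinv_def)
  show sym: "transpose P = P"
    using pinv(2) unfolding P_def by (simp add: vec_eq_iff transpose_def mat_def)
  have AP: "A ** P = 0"
    using pinv(1) by (simp add: P_def matrix_diff_distrib_left matrix_mul_assoc)
  have "P ** P = P - pinv A ** (A ** P)"
    by (subst (1) P_def) (simp add: matrix_diff_distrib_right matrix_mul_assoc)
  then show "P ** P = P" by (simp add: AP)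
  have "trace P = dim {x. A *v x = 0}"
  proof (rule trace_orthogonal_projection[OF sym])
    show "subspace {x. A *v x = 0}"
      by (simp add: subspace_def matrix_vector_right_distrib matrix_vector_mult_scaleR)
    show "P *v x \<in> {x. A *v x = 0}" for x
      by (simp add: matrix_vector_mul_assoc AP)
    show "P *v x = x" if "x \<in> {x. A *v x = 0}" for x
      using that by (simp add: P_def matrix_vector_mult_diff_rdistrib flip: matrix_vector_mul_assoc)
  qed
  then show "trace P = real (nullity A)" by (simp add: dim_kernel_eq_nullity)
qed

section \<open>Positive definiteness of the posterior covariance\<close>

lemma matrix_inv_cancel:
  assumes "invertible M"
  shows "M ** matrix_inv M = mat 1" "matrix_inv M ** M = mat 1"
  using someI_ex[OF assms[unfolded invertible_def]] by (auto simp: matrix_inv_def)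

lemma matrix_inv_unique:
  fixes M :: "real^'n^'n"
  assumes "N ** M = mat 1"
  shows "matrix_inv M = N"
proof -
  have "invertible M"
    using assms by (auto simp: invertible_left_inverse)
  then show ?thesis
    using assms by (metis matrix_inv_cancel(1) matrix_mul_assoc matrix_mul_lid matrix_mul_rid)
qed

lemma sym_pos_def_invertible:
  assumes "sym_pos_def M"
  shows "invertible M"
proof -
  have "x = 0" if "M *v x = 0" for x
    using assms that by (metis inner_zero_right less_irrefl sym_pos_def_def)
  then show ?thesis
    by (simp add: invertible_left_inverse matrix_left_invertible_ker)
qed

lemma sym_pos_def_matrix_inv:
  assumes M: "sym_pos_def M"
  shows "sym_pos_def (matrix_inv M)"
proof -
  note cancel = matrix_inv_cancel[OF sym_pos_def_invertible[OF M]]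
  have sym: "transpose M = M" using M by (simp add: sym_pos_def_def)
  have "transpose (matrix_inv M) ** M = transpose (M ** matrix_inv M)"
    by (simp add: matrix_transpose_mul sym)
  then have "transpose (matrix_inv M) ** M = mat 1"
    by (simp add: cancel)
  then have "transpose (matrix_inv M) = matrix_inv M"
    by (metis matrix_inv_unique)
  moreover have "x \<bullet> (matrix_inv M *v x) > 0" if "x \<noteq> 0" for x
  proof -
    define y where "y = matrix_inv M *v x"
    have My: "M *v y = x" by (simp add: y_def matrix_vector_mul_assoc cancel)
    with that have "y \<noteq> 0" by auto
    then have "y \<bullet> (M *v y) > 0" using M by (simp add: sym_pos_def_def)
    then show ?thesis by (simp add: My inner_commute flip: y_def)
  qed
  ultimately show ?thesis by (simp add: sym_pos_def_def)
qed

text \<open>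
  The posterior precision is the sum of the positive definite prior precision and the positive
  semidefinite term \<open>A\<^sup>T \<Gamma>\<^sup>-\<^sup>1 A\<close>, with \<open>\<Gamma>\<close> the noise covariance.
\<close>

lemma sym_pos_def_Gamma_post:
  fixes A :: "real^'n^'k"
  assumes prior: "sym_pos_def \<Gamma>prior" and noise: "sym_pos_def \<Gamma>noise"
  shows "sym_pos_def (Gamma_post A \<Gamma>prior \<Gamma>noise)"
  unfolding Gamma_post_def
proof (rule sym_pos_def_matrix_inv)
  let ?P = "matrix_inv \<Gamma>prior" and ?N = "matrix_inv \<Gamma>noise"
  have P: "sym_pos_def ?P" and N: "sym_pos_def ?N"
    using assms by (simp_all add: sym_pos_def_matrix_inv)
  show "sym_pos_def (?P + transpose A ** ?N ** A)"
    unfolding sym_pos_def_def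
  proof (intro conjI allI impI)
    show "transpose (?P + transpose A ** ?N ** A) = ?P + transpose A ** ?N ** A"
      using P N by (simp add: sym_pos_def_def transpose_add matrix_transpose_mul matrix_mul_assoc)
    fix x :: "real^'n" assume "x \<noteq> 0"
    then have "x \<bullet> (?P *v x) > 0" using P by (simp add: sym_pos_def_def)
    moreover have "x \<bullet> ((transpose A ** ?N ** A) *v x) = (A *v x) \<bullet> (?N *v (A *v x))"
      by (metis dot_lmul_matrix inner_commute matrix_vector_mul_assoc transpose_matrix_vector)
    moreover have "(A *v x) \<bullet> (?N *v (A *v x)) \<ge> 0"
      using N by (cases "A *v x = 0") (auto simp: sym_pos_def_def less_imp_le)
    ultimately show "x \<bullet> ((?P + transpose A ** ?N ** A) *v x) > 0"
      by (simp add: matrix_vector_mult_add_rdistrib inner_add_right)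
  qed
qed

lemma sym_pos_def_mat_1: "sym_pos_def (mat 1 :: real^'n^'n)"
  by (simp add: sym_pos_def_def)

section \<open>The trace bound and its tightness\<close>

lemma eigval_0:
  assumes "i \<in> {1..CARD('n)}"
  shows "eigval i (0 :: real^'n^'n) = 0"
proof -
  have zero: "mat 1 ** diagonal_matrix (\<lambda>_. 0) ** transpose (mat 1) = (0 :: real^'n^'n)"
    by (simp add: diagonal_matrix_def vec_eq_iff)
  obtain js where js: "distinct js" "set js = (UNIV :: 'n set)"
      "eigvals_desc (0 :: real^'n^'n) = map (\<lambda>_. 0) js"
    by (rule eigvals_desc_enumeration[OF orthogonal_matrix_id, of "\<lambda>_::'n. 0", unfolded zero]) (rule that)
  then have "length js = CARD('n)" by (metis distinct_card)
  then have "i - 1 < length js" using assms by auto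
  then show ?thesis by (simp only: eigval_def js(3) nth_map)
qed

theorem lemmaC1:
  shows "(\<forall>(A :: real^'n^'k) (\<Gamma>prior :: real^'n^'n) (\<Gamma>noise :: real^'k^'k).
            sym_pos_def \<Gamma>prior \<and> sym_pos_def \<Gamma>noise \<longrightarrow>
            delta_prior A \<Gamma>prior \<Gamma>noise
              \<le> (\<Sum>i = 1..nullity A. eigval i (\<Gamma>prior - Gamma_post A \<Gamma>prior \<Gamma>noise)))
       \<and> (\<exists>(A :: real^'n^'k) (\<Gamma>prior :: real^'n^'n) (\<Gamma>noise :: real^'k^'k).
            sym_pos_def \<Gamma>prior \<and> sym_pos_def \<Gamma>noise \<and>
            delta_prior A \<Gamma>prior \<Gamma>noise
              = (\<Sum>i = 1..nullity A. eigval i (\<Gamma>prior - Gamma_post A \<Gamma>prior \<Gamma>noise)))"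
proof (intro conjI allI impI)
  fix A :: "real^'n^'k" and \<Gamma>prior :: "real^'n^'n" and \<Gamma>noise :: "real^'k^'k"
  assume *: "sym_pos_def \<Gamma>prior \<and> sym_pos_def \<Gamma>noise"
  then have "sym_pos_def (Gamma_post A \<Gamma>prior \<Gamma>noise)"
    by (simp add: sym_pos_def_Gamma_post)
  with * have "transpose (\<Gamma>prior - Gamma_post A \<Gamma>prior \<Gamma>noise) = \<Gamma>prior - Gamma_post A \<Gamma>prior \<Gamma>noise"
    by (simp add: transpose_diff sym_pos_def_def)
  then show "delta_prior A \<Gamma>prior \<Gamma>noise
      \<le> (\<Sum>i = 1..nullity A. eigval i (\<Gamma>prior - Gamma_post A \<Gamma>prior \<Gamma>noise))"
    unfolding delta_prior_def by (rule Ky_Fan_projection_bound) (rule kernel_projection)+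
next
  \<comment> \<open>Equality at \<open>A = 0\<close> with identity covariances: prior and posterior coincide.\<close>
  have "transpose (0 :: real^'n^'k) ** X = 0" for X :: "real^'k^'k"
    by (simp add: matrix_matrix_mult_def transpose_def vec_eq_iff)
  then have "Gamma_post (0 :: real^'n^'k) (mat 1) (mat 1) = mat 1"
    by (simp add: Gamma_post_def matrix_inv_unique)
  then have "delta_prior (0 :: real^'n^'k) (mat 1) (mat 1)
      = (\<Sum>i = 1..nullity (0 :: real^'n^'k). eigval i (mat 1 - Gamma_post (0 :: real^'n^'k) (mat 1) (mat 1)))"
    by (simp add: delta_prior_def trace_def nullity_def eigval_0)
  then show "\<exists>(A :: real^'n^'k) (\<Gamma>prior :: real^'n^'n) (\<Gamma>noise :: real^'k^'k).
      sym_pos_def \<Gamma>prior \<and> sym_pos_def \<Gamma>noise \<and>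
      delta_prior A \<Gamma>prior \<Gamma>noise
        = (\<Sum>i = 1..nullity A. eigval i (\<Gamma>prior - Gamma_post A \<Gamma>prior \<Gamma>noise))"
    by (intro exI[of _ 0] exI[of _ "mat 1"] conjI sym_pos_def_mat_1)
qed

end
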